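(* Let $G$ be a finitely generated group possessing a subgroup of finite index with unsolvable conjugacy problem. Then $G$ has a finite index overgroup with unsolvable conjugacy problem.
   Context: A finite index overgroup of $G$ is a group $K$ containing $G$ as a subgroup with $|K:G|<\infty$. For a group $A$ generated by a finite set $Z$, the conjugacy problem in $A$ is solvable if there is an algorithm which, given two words over $Z^{\pm1}$, decides whether or not the elements of $A$ they represent are conjugate in $A$; otherwise it is unsolvable. *)

theory Defs
  imports "HOL-Algebra.Algebra" "HOL-Library.Nat_Bijection"
begin

text \<open>
  The total recursive functions in Kleene's sense: the least class containing the initial functions
  and closed under composition, primitive recursion and minimisation of regular functions.  An
  \<open>n\<close>-ary function is a function on lists that matters only on lists of length \<open>n\<close>, hence the
  extensionality rule \<open>ext\<close>.
\<close>

inductive recursive :: "nat \<Rightarrow> (nat list \<Rightarrow> nat) \<Rightarrow> bool" where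
  zero: "recursive n (\<lambda>xs. 0)"
| succ: "recursive 1 (\<lambda>xs. Suc (xs ! 0))"
| proj: "i < n \<Longrightarrow> recursive n (\<lambda>xs. xs ! i)"
| comp: "recursive (length gs) f \<Longrightarrow> (\<forall>g\<in>set gs. recursive n g) \<Longrightarrow>
           recursive n (\<lambda>xs. f (map (\<lambda>g. g xs) gs))"
| prec: "recursive n f \<Longrightarrow> recursive (Suc (Suc n)) g \<Longrightarrow>
           recursive (Suc n) (\<lambda>xs. rec_nat (f (tl xs)) (\<lambda>y r. g (y # r # tl xs)) (hd xs))"
| mini: "recursive (Suc n) f \<Longrightarrow> (\<forall>xs. length xs = n \<longrightarrow> (\<exists>y. f (y # xs) = 0)) \<Longrightarrow>
           recursive n (\<lambda>xs. LEAST y. f (y # xs) = 0)"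
| ext:  "recursive n f \<Longrightarrow> (\<forall>xs. length xs = n \<longrightarrow> g xs = f xs) \<Longrightarrow> recursive n g"

definition finite_generating_set :: "('a, 'b) monoid_scheme \<Rightarrow> 'a set \<Rightarrow> bool" where
  "finite_generating_set A Z \<longleftrightarrow> finite Z \<and> Z \<subseteq> carrier A \<and> generate A Z = carrier A"

text \<open>
  A word over \<open>Z\<close> and the inverses of its elements is an element of \<open>lists (Z \<times> UNIV)\<close>: the letter
  \<open>(z, True)\<close> stands for \<open>z\<close>, the letter \<open>(z, False)\<close> for the formal inverse of \<open>z\<close>.
\<close>

definition letter_val :: "('a, 'b) monoid_scheme \<Rightarrow> 'a \<times> bool \<Rightarrow> 'a" where
  "letter_val A l = (if snd l then fst l else inv\<^bsub>A\<^esub> (fst l))"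

definition word_val :: "('a, 'b) monoid_scheme \<Rightarrow> ('a \<times> bool) list \<Rightarrow> 'a" where
  "word_val A w = foldr (\<lambda>l x. letter_val A l \<otimes>\<^bsub>A\<^esub> x) w \<one>\<^bsub>A\<^esub>"

definition conjugate_in :: "('a, 'b) monoid_scheme \<Rightarrow> 'a \<Rightarrow> 'a \<Rightarrow> bool" where
  "conjugate_in A x y \<longleftrightarrow> (\<exists>g\<in>carrier A. y = g \<otimes>\<^bsub>A\<^esub> x \<otimes>\<^bsub>A\<^esub> inv\<^bsub>A\<^esub> g)"

definition word_code :: "('a \<Rightarrow> nat) \<Rightarrow> ('a \<times> bool) list \<Rightarrow> nat" where
  "word_code e w = list_encode (map (\<lambda>(z, b). 2 * e z + of_bool b) w)"

text \<open>
  Words are presented to the algorithm as numbers, via a numbering \<open>e\<close> of the finite set \<open>Z\<close>.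
  Any two numberings of \<open>Z\<close> differ by a finite table, so it is immaterial which one is used.  The
  values of \<open>f\<close> on numbers that are not codes of words are unconstrained; as the set of codes
  is decidable, demanding that \<open>f\<close> be total is no restriction.
\<close>

definition conjugacy_problem_solvable :: "('a, 'b) monoid_scheme \<Rightarrow> 'a set \<Rightarrow> bool" where
  "conjugacy_problem_solvable A Z \<longleftrightarrow>
     (\<exists>e f. inj_on e Z \<and> recursive 2 f \<and>
        (\<forall>u\<in>lists (Z \<times> UNIV). \<forall>v\<in>lists (Z \<times> UNIV).
           f [word_code e u, word_code e v] =
             (if conjugate_in A (word_val A u) (word_val A v) then 1 else 0)))"

definition finite_index :: "'a set \<Rightarrow> ('a, 'b) monoid_scheme \<Rightarrow> bool" where
  "finite_index H G \<longleftrightarrow> subgroup H G \<and> finite (rcosets\<^bsub>G\<^esub> H)"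

text \<open>
  The inclusion of \<open>G\<close> in an overgroup \<open>K\<close> is an injective homomorphism \<open>\<phi>\<close>, since the element type
  of \<open>G\<close> need not have room for further elements.
\<close>

definition finite_index_overgroup ::
    "('a, 'b) monoid_scheme \<Rightarrow> ('a \<Rightarrow> 'c) \<Rightarrow> ('c, 'd) monoid_scheme \<Rightarrow> bool" where
  "finite_index_overgroup G \<phi> K \<longleftrightarrow>
     group K \<and> \<phi> \<in> mon G K \<and> finite_index (\<phi> ` carrier G) K"

end

theory Submission
  imports Defs
begin

text \<open>
  Let \<open>G\<close> act on the finitely many cosets of \<open>H\<close> and let \<open>K\<close> be the resulting permutational wreath
  product of the group of order two with \<open>G\<close>; it contains \<open>G\<close> with finite index.  Let \<open>t\<close> be the
  element of the base group supported at the coset \<open>H\<close>, whose centraliser in \<open>G\<close> is \<open>H\<close>.  For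
  \<open>x, y \<in> H\<close>, if \<open>yt\<close> is the conjugate of \<open>xt\<close> by \<open>(g, B)\<close>, then \<open>y = gxg\<^sup>-\<^sup>1\<close>; since \<open>x\<close> fixes the
  coset \<open>H\<close>, the contributions of \<open>B\<close> at that coset cancel, so that \<open>t\<close> and its translate by \<open>g\<close>
  agree there, which means \<open>g \<in> H\<close>.  Hence \<open>xt\<close> and \<open>yt\<close> are conjugate in \<open>K\<close> if and only if \<open>x\<close> and
  \<open>y\<close> are conjugate in \<open>H\<close>, and substituting words over the generators of \<open>K\<close> for the letters of
  \<open>H\<close> reduces the conjugacy problem of \<open>H\<close> to that of \<open>K\<close>.
\<close>

section \<open>Closure properties of the recursive functions\<close>

lemma recursive_cong:
  assumes "recursive n f" "\<And>xs. length xs = n \<Longrightarrow> g xs = f xs"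
  shows "recursive n g"
  using recursive.ext[OF assms(1)] assms(2) by blast

lemma recursive_comp1:
  assumes "recursive 1 (\<lambda>xs. F (xs ! 0))" "recursive n g"
  shows "recursive n (\<lambda>xs. F (g xs))"
proof -
  have "recursive n (\<lambda>xs. (\<lambda>ys. F (ys ! 0)) (map (\<lambda>g. g xs) [g]))"
    by (rule recursive.comp) (use assms in auto)
  then show ?thesis by simp
qed

lemma recursive_comp2:
  assumes "recursive 2 (\<lambda>xs. F (xs ! 0) (xs ! 1))" "recursive n g" "recursive n h"
  shows "recursive n (\<lambda>xs. F (g xs) (h xs))"
proof -
  have "recursive n (\<lambda>xs. (\<lambda>ys. F (ys ! 0) (ys ! 1)) (map (\<lambda>g. g xs) [g, h]))"
    by (rule recursive.comp) (use assms in \<open>auto simp: numeral_2_eq_2\<close>)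
  then show ?thesis by simp
qed

text \<open>In \<open>recursive.prec\<close> the recursion runs on the first argument. Composing
  with \<open>k\<close> and all projections makes it run up to a recursive bound, while the step
  still sees all of \<open>xs\<close>. The projections reproduce \<open>xs\<close> only at length
  \<open>n\<close>, which is enough by extensionality.\<close>

lemma recursive_rec:
  assumes "recursive n f" "recursive (Suc (Suc n)) g" "recursive n k"
  shows "recursive n (\<lambda>xs. rec_nat (f xs) (\<lambda>y r. g (y # r # xs)) (k xs))"
proof -
  let ?R = "\<lambda>xs. rec_nat (f (tl xs)) (\<lambda>y r. g (y # r # tl xs)) (hd xs)"
  let ?gs = "k # map (\<lambda>i xs. xs ! i) [0..<n]"
  have "recursive n (\<lambda>xs. ?R (map (\<lambda>g. g xs) ?gs))"
    by (rule recursive.comp) (use assms in \<open>auto intro: recursive.intros\<close>)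
  moreover have "map (\<lambda>g. g xs) ?gs = k xs # xs" if "length xs = n" for xs :: "nat list"
    using that by (auto intro: nth_equalityI)
  ultimately show ?thesis
    by (elim recursive_cong) simp
qed

lemma recursive_Suc:
  assumes "recursive n f"
  shows "recursive n (\<lambda>xs. Suc (f xs))"
  using recursive_comp1[OF _ assms, of Suc] recursive.succ by simp

lemma recursive_const: "recursive n (\<lambda>xs. c)"
  by (induction c) (auto intro: recursive.zero recursive_Suc)

lemma recursive_if:
  assumes "recursive n c" "recursive n f" "recursive n g"
  shows "recursive n (\<lambda>xs. if c xs = 0 then f xs else g xs)"
proof -
  have *: "recursive 3 (\<lambda>xs. if xs ! 0 = 0 then xs ! 1 else xs ! 2)"
  proof -
    \<comment> \<open>Recursion on the condition: the base case returns the second argument, and the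
      step discards counter and accumulator. Index 3 of \<open>y # r # tl xs\<close> is the third
      argument.\<close>
    have "recursive (Suc 2) (\<lambda>xs. rec_nat ((\<lambda>xs. xs ! 0) (tl xs))
        (\<lambda>y r. (\<lambda>xs. xs ! 3) (y # r # tl xs)) (hd xs))"
      by (intro recursive.prec recursive.proj) auto
    then have "recursive (Suc 2) (\<lambda>xs. if xs ! 0 = 0 then xs ! 1 else xs ! 2)"
      by (rule recursive_cong) (auto simp: length_Suc_conv numeral_2_eq_2 gr0_conv_Suc)
    then show ?thesis by simp
  qed
  have "recursive n (\<lambda>xs. (\<lambda>xs. if xs ! 0 = 0 then xs ! 1 else xs ! 2) (map (\<lambda>g. g xs) [c, f, g]))"
    by (rule recursive.comp) (use assms * in \<open>auto simp: numeral_3_eq_3\<close>)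
  then show ?thesis by (simp cong: if_cong)
qed

lemma recursive_pred:
  assumes "recursive n f"
  shows "recursive n (\<lambda>xs. f xs - 1)"
proof -
  have "recursive n (\<lambda>xs. rec_nat ((\<lambda>_. 0) xs) (\<lambda>y r. (\<lambda>ys. ys ! 0) (y # r # xs)) (f xs))"
    by (intro recursive_rec recursive.zero recursive.proj assms) auto
  moreover have "rec_nat 0 (\<lambda>y r. y) m = m - 1" for m :: nat
    by (cases m) auto
  ultimately show ?thesis by simp
qed

lemma recursive_add:
  assumes "recursive n f" "recursive n g"
  shows "recursive n (\<lambda>xs. f xs + g xs)"
proof -
  have "recursive n (\<lambda>xs. rec_nat (f xs) (\<lambda>y r. (\<lambda>ys. Suc (ys ! 1)) (y # r # xs)) (g xs))"
    by (intro recursive_rec recursive_Suc recursive.proj assms) auto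
  moreover have "rec_nat a (\<lambda>y. Suc) m = a + m" for a m :: nat
    by (induction m) auto
  ultimately show ?thesis by simp
qed

lemma recursive_diff:
  assumes "recursive n f" "recursive n g"
  shows "recursive n (\<lambda>xs. f xs - g xs)"
proof -
  have "recursive n (\<lambda>xs. rec_nat (f xs) (\<lambda>y r. (\<lambda>ys. ys ! 1 - 1) (y # r # xs)) (g xs))"
    by (intro recursive_rec recursive_pred recursive.proj assms) auto
  moreover have "rec_nat a (\<lambda>y r. r - Suc 0) m = a - m" for a m :: nat
    by (induction m) auto
  ultimately show ?thesis by simp
qed

text \<open>Two numbers are equal exactly when both truncated differences vanish, that is, when
  their sum is 0.\<close>

lemma recursive_if_eq:
  assumes "recursive n c" "recursive n d" "recursive n f" "recursive n g"
  shows "recursive n (\<lambda>xs. if c xs = d xs then f xs else g xs)"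
proof -
  have "recursive n (\<lambda>xs. if (c xs - d xs) + (d xs - c xs) = 0 then f xs else g xs)"
    by (intro recursive_if recursive_add recursive_diff assms)
  then show ?thesis by (rule recursive_cong) auto
qed

section \<open>Cantor's pairing function and its inverse\<close>

lemma recursive_triangle:
  assumes "recursive n f"
  shows "recursive n (\<lambda>xs. triangle (f xs))"
proof -
  have "recursive n (\<lambda>xs. rec_nat ((\<lambda>_. 0) xs) (\<lambda>y r. (\<lambda>ys. ys ! 1 + Suc (ys ! 0)) (y # r # xs)) (f xs))"
    by (intro recursive_rec recursive_add recursive_Suc recursive.zero recursive.proj assms) auto
  moreover have "rec_nat 0 (\<lambda>y r. Suc (r + y)) m = triangle m" for m :: nat
    by (induction m) auto
  ultimately show ?thesis by simp
qed

lemma recursive_prod_encode: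
  assumes "recursive n f" "recursive n g"
  shows "recursive n (\<lambda>xs. prod_encode (f xs, g xs))"
  unfolding prod_encode_def prod.case
  by (intro recursive_add recursive_triangle assms)

lemma mono_triangle: "mono triangle"
  by (simp add: mono_iff_le_Suc)

text \<open>The pairing counts along diagonals: if \<open>p\<close> codes \<open>(a, b)\<close>,
  then \<open>p = triangle (a + b) + a\<close> lies below \<open>triangle (Suc (a + b))\<close>. So
  the diagonal \<open>a + b\<close> is the least \<open>y\<close> with
  \<open>p < triangle (Suc y)\<close>; the truncated difference puts this into the form of
  \<open>recursive.mini\<close>.\<close>

lemma prod_decode_eq_Least:
  fixes p :: nat
  defines "s \<equiv> (LEAST y. Suc p - triangle (Suc y) = 0)"
  shows "prod_decode p = (p - triangle s, s - (p - triangle s))"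
proof -
  obtain a b where ab: "prod_decode p = (a, b)" by fastforce
  then have p: "p = triangle (a + b) + a"
    using prod_decode_inverse[of p] by (simp add: prod_encode_def)
  have "s = a + b"
    unfolding s_def
  proof (rule Least_equality)
    fix y assume y: "Suc p - triangle (Suc y) = 0"
    show "a + b \<le> y"
    proof (rule ccontr)
      assume "\<not> a + b \<le> y"
      then have "triangle (Suc y) \<le> triangle (a + b)"
        by (intro monoD[OF mono_triangle]) simp
      then show False using y p by simp
    qed
  qed (simp add: p)
  then show ?thesis using ab p by simp
qed

lemma recursive_prod_decode:
  assumes "recursive n f"
  shows "recursive n (\<lambda>xs. fst (prod_decode (f xs)))"
    and "recursive n (\<lambda>xs. snd (prod_decode (f xs)))"
proof -
  let ?s = "\<lambda>p. LEAST y. Suc p - triangle (Suc y) = 0"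
  have "recursive 1 (\<lambda>xs. LEAST y. (\<lambda>ys. Suc (ys ! 1) - triangle (Suc (ys ! 0))) (y # xs) = 0)"
  proof (rule recursive.mini)
    show "\<forall>xs. length xs = 1 \<longrightarrow> (\<exists>y. Suc ((y # xs) ! 1) - triangle (Suc ((y # xs) ! 0)) = 0)"
    proof (intro allI impI)
      fix xs :: "nat list"
      show "\<exists>y. Suc ((y # xs) ! 1) - triangle (Suc ((y # xs) ! 0)) = 0"
        \<comment> \<open>The search always succeeds, since
          \<open>p < triangle (Suc p)\<close>.\<close>
        by (intro exI[of _ "xs ! 0"]) simp
    qed
  qed (intro recursive_diff recursive_triangle recursive_Suc recursive.proj; simp)
  then have "recursive 1 (\<lambda>xs. ?s (xs ! 0))" by simp
  from recursive_comp1[OF this assms] have s: "recursive n (\<lambda>xs. ?s (f xs))" .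
  then show "recursive n (\<lambda>xs. fst (prod_decode (f xs)))"
    unfolding prod_decode_eq_Least fst_conv
    by (intro recursive_diff recursive_triangle assms)
  show "recursive n (\<lambda>xs. snd (prod_decode (f xs)))"
    using s unfolding prod_decode_eq_Least snd_conv
    by (intro recursive_diff recursive_triangle assms)
qed

section \<open>Computing with codes of lists\<close>

definition code_tl :: "nat \<Rightarrow> nat" where
  "code_tl c = snd (prod_decode (c - 1))"

definition code_hd :: "nat \<Rightarrow> nat" where
  "code_hd c = fst (prod_decode (c - 1))"

text \<open>A nonempty list is coded by the successor of the pair of its head and the code of its
  tail, and \<open>[]\<close> by 0. Since \<open>0 - 1 = 0\<close> decodes to \<open>(0, 0)\<close>,
  \<open>code_tl\<close> fixes 0, so the equation persists when \<open>k\<close> exceeds the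
  length.\<close>

lemma code_tl_funpow: "(code_tl ^^ k) (list_encode w) = list_encode (drop k w)"
proof (induction k arbitrary: w)
  case (Suc k)
  have "code_tl (list_encode w) = list_encode (tl w)"
  proof (cases w)
    case Nil
    have "prod_decode 0 = (0, 0)"
      using prod_encode_inverse[of "(0, 0)"] by (simp add: prod_encode_def)
    with Nil show ?thesis by (simp add: code_tl_def)
  qed (simp add: code_tl_def)
  then show ?case using Suc[of "tl w"] by (simp add: funpow_Suc_right drop_Suc del: funpow.simps)
qed simp

text \<open>This lets the code of a list bound the number of rounds of a loop over that
  list.\<close>

lemma length_le_list_encode: "length w \<le> list_encode w"
proof (induction w)
  case (Cons a w)
  then show ?case using le_prod_encode_2[of "list_encode w" a] by simp
qed simp

lemma recursive_code_tl_funpow: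
  assumes "recursive n f" "recursive n g"
  shows "recursive n (\<lambda>xs. (code_tl ^^ f xs) (g xs))"
proof -
  have "recursive n (\<lambda>xs. rec_nat (g xs) (\<lambda>y r. (\<lambda>ys. code_tl (ys ! 1)) (y # r # xs)) (f xs))"
    unfolding code_tl_def
    by (intro recursive_rec recursive_prod_decode recursive_pred recursive.proj assms) auto
  moreover have "rec_nat a (\<lambda>y. code_tl) m = (code_tl ^^ m) a" for a m :: nat
    by (induction m) auto
  ultimately show ?thesis by simp
qed

text \<open>The prefix \<open>w\<close> is fixed, so the function is a composition of
  \<open>length w\<close> pairings with constants.\<close>

lemma recursive_list_encode_append:
  assumes "recursive n f"
  shows "recursive n (\<lambda>xs. list_encode (w @ list_decode (f xs)))"
  by (induction w) (auto intro!: assms recursive_Suc recursive_prod_encode recursive_const)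

text \<open>An arbitrary \<open>\<sigma>\<close> on a finite set is a finite table, realised by one
  equality test for each entry.\<close>

lemma recursive_prefix_table:
  assumes "finite L"
  shows "recursive 2 (\<lambda>xs. if xs ! 0 \<in> L then list_encode (\<sigma> (xs ! 0) @ list_decode (xs ! 1)) else 0)"
  using assms
proof (induction L)
  case (insert l L)
  let ?F = "\<lambda>xs. if xs ! 0 \<in> L then list_encode (\<sigma> (xs ! 0) @ list_decode (xs ! 1)) else 0"
  have "recursive 2 (\<lambda>xs. if xs ! 0 = l then list_encode (\<sigma> l @ list_decode (xs ! 1)) else ?F xs)"
    by (intro recursive_if_eq recursive_list_encode_append recursive_const insert.IH recursive.proj) auto
  then show ?case by (rule recursive_cong) auto
qed (simp add: recursive.zero)

text \<open>
  The blocks come out in reverse order because the input is read from the front while the output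
  grows at the front.
\<close>

lemma recursive_reverse_substitution:
  assumes "finite L"
  obtains T where "recursive 1 (\<lambda>xs. T (xs ! 0))"
    and "\<And>w. w \<in> lists L \<Longrightarrow> T (list_encode w) = list_encode (concat (rev (map \<sigma> w)) @ t)"
proof -
  define P where "P = (\<lambda>l r. if l \<in> L then list_encode (\<sigma> l @ list_decode r) else 0)"
  \<comment> \<open>The remainder of the input has code 0 exactly when it is exhausted; from then on
    the accumulator \<open>r\<close> is kept.\<close>
  define S where "S = (\<lambda>y r c. if (code_tl ^^ y) c = 0 then r else P (code_hd ((code_tl ^^ y) c)) r)"
  define R where "R = (\<lambda>c. rec_nat (list_encode t) (\<lambda>y r. S y r c))"
  have P: "recursive 2 (\<lambda>xs. P (xs ! 0) (xs ! 1))"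
    unfolding P_def by (rule recursive_prefix_table[OF assms])
  have "recursive (Suc (Suc 1)) (\<lambda>ys. S (ys ! 0) (ys ! 1) (ys ! 2))"
    unfolding S_def code_hd_def
    by (intro recursive_if recursive_code_tl_funpow recursive_comp2[OF P] recursive_prod_decode
        recursive_pred recursive.proj) auto
  then have "recursive 1 (\<lambda>xs. rec_nat ((\<lambda>_. list_encode t) xs)
      (\<lambda>y r. (\<lambda>ys. S (ys ! 0) (ys ! 1) (ys ! 2)) (y # r # xs)) (xs ! 0))"
    by (intro recursive_rec recursive_const recursive.proj) auto
  then have "recursive 1 (\<lambda>xs. R (xs ! 0) (xs ! 0))"
    by (simp add: R_def)
  moreover have "R (list_encode w) (list_encode w) = list_encode (concat (rev (map \<sigma> w)) @ t)"
    if w: "w \<in> lists L" for w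
  proof -
    \<comment> \<open>Loop invariant: after \<open>k\<close> rounds the first \<open>k\<close>
      letters have been translated. The number of rounds is separated from the input to allow
      induction on it.\<close>
    have "R (list_encode w) k = list_encode (concat (rev (map \<sigma> (take k w))) @ t)" for k
    proof (induction k)
      case (Suc k)
      show ?case
      proof (cases "k < length w")
        case True
        then have "drop k w = w ! k # drop (Suc k) w" by (rule Cons_nth_drop_Suc[symmetric])
        moreover have "w ! k \<in> L" using w True by auto
        ultimately show ?thesis
          using Suc True by (simp add: R_def S_def P_def code_tl_funpow code_hd_def take_Suc_conv_app_nth)
      next
        case False
        then show ?thesis using Suc by (simp add: R_def S_def code_tl_funpow)
      qed
    qed (simp add: R_def)
    \<comment> \<open>With the code of \<open>w\<close> as the number of rounds, \<open>take\<close>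
      returns all of \<open>w\<close>.\<close>
    then show ?thesis by (simp add: length_le_list_encode)
  qed
  ultimately show thesis by (rule that[of "\<lambda>c. R c c"])
qed

section \<open>Words, conjugacy, and reductions between conjugacy problems\<close>

lemma (in group) letter_val_closed:
  assumes "Z \<subseteq> carrier G" "l \<in> Z \<times> UNIV"
  shows "letter_val G l \<in> carrier G"
  using assms by (auto simp: letter_val_def)

lemma word_val_Nil [simp]: "word_val A [] = \<one>\<^bsub>A\<^esub>"
  and word_val_Cons [simp]: "word_val A (l # w) = letter_val A l \<otimes>\<^bsub>A\<^esub> word_val A w"
  by (simp_all add: word_val_def)

lemma (in group) word_val_closed:
  assumes "Z \<subseteq> carrier G" "w \<in> lists (Z \<times> UNIV)"
  shows "word_val G w \<in> carrier G"
  using assms(2) by induction (auto intro: letter_val_closed[OF assms(1)])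

lemma (in group) word_val_append:
  assumes Z: "Z \<subseteq> carrier G" and "u \<in> lists (Z \<times> UNIV)" "v \<in> lists (Z \<times> UNIV)"
  shows "word_val G (u @ v) = word_val G u \<otimes> word_val G v"
  using assms(2)
  by induction
    (use assms in \<open>auto simp: m_assoc letter_val_closed[OF Z] word_val_closed[OF Z]\<close>)

lemma (in group) generate_imp_word_val:
  assumes "Z \<subseteq> carrier G" "x \<in> generate G Z"
  shows "\<exists>w\<in>lists (Z \<times> UNIV). word_val G w = x"
  using assms(2)
proof induction
  case one
  show ?case by (rule bexI[of _ "[]"]) auto
next
  case (incl z)
  then show ?case
    using assms(1) by (intro bexI[of _ "[(z, True)]"]) (auto simp: letter_val_def)
next
  case (inv z)
  then show ?case
    using assms(1) by (intro bexI[of _ "[(z, False)]"]) (auto simp: letter_val_def)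
next
  case (eng x y)
  then obtain u v where "u \<in> lists (Z \<times> UNIV)" "v \<in> lists (Z \<times> UNIV)"
    "word_val G u = x" "word_val G v = y" by blast
  then show ?case
    by (intro bexI[of _ "u @ v"]) (auto simp: word_val_append[OF assms(1)])
qed

text \<open>Without inverses, conjugacy can be tested in the wreath product by its multiplication
  alone, and transported along isomorphisms.\<close>

lemma (in group) conjugate_in_iff:
  assumes "x \<in> carrier G" "y \<in> carrier G"
  shows "conjugate_in G x y \<longleftrightarrow> (\<exists>g\<in>carrier G. y \<otimes> g = g \<otimes> x)"
  unfolding conjugate_in_def using assms by (metis inv_solve_right m_closed)

lemma (in group) conjugate_in_inv:
  assumes "x \<in> carrier G" "y \<in> carrier G" "conjugate_in G x y"
  shows "conjugate_in G (inv x) (inv y)"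
  using assms unfolding conjugate_in_def by (auto simp: inv_mult_group m_assoc)

lemma (in group) conjugate_in_inv_iff:
  assumes "x \<in> carrier G" "y \<in> carrier G"
  shows "conjugate_in G (inv x) (inv y) \<longleftrightarrow> conjugate_in G x y"
  using conjugate_in_inv[of x y] conjugate_in_inv[of "inv x" "inv y"] assms by auto

text \<open>
  The substitution reverses the order of the letters, so each letter is replaced by a word for its
  inverse: the new word represents the inverse of the old element, and passing to inverses
  preserves conjugacy.
\<close>

lemma conjugacy_problem_solvable_reduction:
  assumes L: "group L" "finite Y" "Y \<subseteq> carrier L"
    and K: "group K" "finite_generating_set K Z" "conjugacy_problem_solvable K Z"
    and \<rho>: "\<rho> \<in> hom L K" and t: "t \<in> carrier K"
    and conj: "\<And>x y. x \<in> carrier L \<Longrightarrow> y \<in> carrier L \<Longrightarrow>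
      conjugate_in K (\<rho> x \<otimes>\<^bsub>K\<^esub> t) (\<rho> y \<otimes>\<^bsub>K\<^esub> t) \<longleftrightarrow> conjugate_in L x y"
  shows "conjugacy_problem_solvable L Y"
proof -
  interpret L: group L by fact
  interpret K: group K by fact
  interpret \<rho>: group_hom L K \<rho> by unfold_locales fact
  have Z: "Z \<subseteq> carrier K" "generate K Z = carrier K"
    using K(2) by (auto simp: finite_generating_set_def)
  have word: "\<exists>w\<in>lists (Z \<times> UNIV). word_val K w = x" if "x \<in> carrier K" for x
    using K.generate_imp_word_val Z that by simp
  obtain e f where f: "recursive 2 f"
    and f_eq: "\<And>u v. u \<in> lists (Z \<times> UNIV) \<Longrightarrow> v \<in> lists (Z \<times> UNIV) \<Longrightarrow>
      f [word_code e u, word_code e v] =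
        (if conjugate_in K (word_val K u) (word_val K v) then 1 else 0)"
    using K(3) unfolding conjugacy_problem_solvable_def by metis
  \<comment> \<open>Solvability asks only for some numbering, so any injection on \<open>Y\<close>
    serves, whereas \<open>e\<close> comes with the algorithm for \<open>K\<close>.\<close>
  obtain d :: "_ \<Rightarrow> nat" where d: "inj_on d Y"
    using finite_imp_inj_to_nat_seg[OF L(2)] by blast
  define code where "code = (\<lambda>(y, b). 2 * d y + of_bool b)"
  have code: "inj_on code (Y \<times> UNIV)"
  proof (rule inj_onI)
    fix p q assume *: "p \<in> Y \<times> UNIV" "q \<in> Y \<times> UNIV" "code p = code q"
    obtain y b z c where pq: "p = (y, b)" "q = (z, c)" by fastforce
    have eq: "2 * d y + of_bool b = 2 * d z + of_bool c"
      using *(3) by (simp add: code_def pq)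
    \<comment> \<open>The parity of a letter code tells a generator from a formal inverse.\<close>
    have "b = c" using arg_cong[OF eq, of even] by (cases b; cases c) simp_all
    then show "p = q" using eq inj_onD[OF d] *(1,2) by (auto simp: pq)
  qed
  have "\<exists>\<tau>. \<forall>l\<in>Y \<times> UNIV. \<tau> l \<in> lists (Z \<times> UNIV) \<and> word_val K (\<tau> l) = \<rho> (inv\<^bsub>L\<^esub> letter_val L l)"
    using word[OF \<rho>.hom_closed[OF L.inv_closed[OF L.letter_val_closed[OF L(3)]]]]
    by (intro bchoice) blast
  then obtain \<tau> where \<tau>_spec: "\<forall>l\<in>Y \<times> UNIV. \<tau> l \<in> lists (Z \<times> UNIV) \<and>
      word_val K (\<tau> l) = \<rho> (inv\<^bsub>L\<^esub> letter_val L l)"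
    by (rule exE)
  have \<tau>: "\<tau> l \<in> lists (Z \<times> UNIV)"
    and \<tau>_val: "word_val K (\<tau> l) = \<rho> (inv\<^bsub>L\<^esub> letter_val L l)" if "l \<in> Y \<times> UNIV" for l
    using bspec[OF \<tau>_spec that] by (rule conjunct1, rule conjunct2)
  obtain s where s: "s \<in> lists (Z \<times> UNIV)" "word_val K s = t"
    using word[OF t] by blast
  \<comment> \<open>The trailing word \<open>s\<close> supplies the factor \<open>t\<close>.\<close>
  define subst where "subst = (\<lambda>w. concat (rev (map \<tau> w)) @ s)"
  have subst_lists: "subst w \<in> lists (Z \<times> UNIV)" if "w \<in> lists (Y \<times> UNIV)" for w
    using that s(1) \<tau> unfolding subst_def by induction auto
  have subst_val: "word_val K (subst w) = \<rho> (inv\<^bsub>L\<^esub> word_val L w) \<otimes>\<^bsub>K\<^esub> t"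
    if "w \<in> lists (Y \<times> UNIV)" for w
  proof -
    have "concat (rev (map \<tau> w)) \<in> lists (Z \<times> UNIV) \<and>
        word_val K (concat (rev (map \<tau> w))) = \<rho> (inv\<^bsub>L\<^esub> word_val L w)"
      using that
    proof induction
      case (Cons l w)
      then show ?case
        using \<tau>[of l] L.letter_val_closed[OF L(3), of l] L.word_val_closed[OF L(3), of w]
        by (simp add: K.word_val_append[OF Z(1)] \<tau>_val L.inv_mult_group)
    qed simp
    then show ?thesis
      using s by (simp add: subst_def K.word_val_append[OF Z(1)])
  qed
  \<comment> \<open>This is \<open>\<tau>\<close> on the level of letter codes. Choosing preimages
    and words is harmless because only the finitely many codes of letters over \<open>Y\<close>
    matter.\<close>
  define \<sigma> where "\<sigma> = (\<lambda>c. map (\<lambda>(z, b). 2 * e z + of_bool b) (\<tau> (inv_into (Y \<times> UNIV) code c)))"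
  have "finite (code ` (Y \<times> UNIV))" using L(2) by simp
  then obtain T where T: "recursive 1 (\<lambda>xs. T (xs ! 0))"
    and T_eq: "\<And>w. w \<in> lists (code ` (Y \<times> UNIV)) \<Longrightarrow>
      T (list_encode w) = list_encode (concat (rev (map \<sigma> w)) @ map (\<lambda>(z, b). 2 * e z + of_bool b) s)"
    by (rule recursive_reverse_substitution[where \<sigma> = \<sigma>]) blast
  have T_code: "T (word_code d w) = word_code e (subst w)" if w: "w \<in> lists (Y \<times> UNIV)" for w
  proof -
    have "map code w \<in> lists (code ` (Y \<times> UNIV))"
      using w by (simp only: lists_image imageI)
    then have "T (word_code d w) = list_encode
        (concat (rev (map \<sigma> (map code w))) @ map (\<lambda>(z, b). 2 * e z + of_bool b) s)"
      by (simp only: word_code_def T_eq flip: code_def)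
    also have "map \<sigma> (map code w) = map (\<lambda>l. map (\<lambda>(z, b). 2 * e z + of_bool b) (\<tau> l)) w"
      using w by (auto simp: \<sigma>_def code lists_eq_set)
    finally show ?thesis
      by (simp add: word_code_def subst_def map_concat rev_map comp_def)
  qed
  have "recursive 2 (\<lambda>xs. f [T (xs ! 0), T (xs ! 1)])"
  proof -
    have "recursive 2 (\<lambda>xs. f (map (\<lambda>g. g xs) [\<lambda>xs. T (xs ! 0), \<lambda>xs. T (xs ! 1)]))"
      by (rule recursive.comp) (use f in \<open>auto intro!: recursive_comp1[OF T] recursive.proj simp: numeral_2_eq_2\<close>)
    then show ?thesis by simp
  qed
  \<comment> \<open>Here \<open>conj\<close> is applied to the inverses of the two word values, and
    \<open>L.conjugate_in_inv_iff\<close> then removes these inverses.\<close>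
  moreover have "f [T (word_code d u), T (word_code d v)] =
      (if conjugate_in L (word_val L u) (word_val L v) then 1 else 0)"
    if "u \<in> lists (Y \<times> UNIV)" "v \<in> lists (Y \<times> UNIV)" for u v
    using that L.word_val_closed[OF L(3)]
    by (simp add: T_code f_eq subst_lists subst_val conj L.conjugate_in_inv_iff del: \<rho>.hom_inv)
  ultimately show ?thesis
    unfolding conjugacy_problem_solvable_def using d
    by (intro exI[of _ d] exI[of _ "\<lambda>xs. f [T (xs ! 0), T (xs ! 1)]"]) simp
qed

section \<open>The wreath product over the coset space\<close>

definition left_invariant_sets :: "('a, 'b) monoid_scheme \<Rightarrow> 'a set \<Rightarrow> 'a set set" where
  "left_invariant_sets G H = {B. B \<subseteq> carrier G \<and> (\<forall>h\<in>H. \<forall>x\<in>B. h \<otimes>\<^bsub>G\<^esub> x \<in> B)}"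

text \<open>
  A left invariant set is a set of right cosets of \<open>H\<close>, so this is the permutational wreath product
  of the group with two elements and \<open>G\<close> acting on the right cosets of \<open>H\<close>.
\<close>

definition coset_wreath :: "('a, 'b) monoid_scheme \<Rightarrow> 'a set \<Rightarrow> ('a \<times> 'a set) monoid" where
  "coset_wreath G H =
    \<lparr>carrier = carrier G \<times> left_invariant_sets G H,
     monoid.mult = (\<lambda>(g, A) (h, B). (g \<otimes>\<^bsub>G\<^esub> h, sym_diff {x \<in> carrier G. x \<otimes>\<^bsub>G\<^esub> inv\<^bsub>G\<^esub> h \<in> A} B)),
     one = (\<one>\<^bsub>G\<^esub>, {})\<rparr>"

lemma coset_wreath_simps [simp]:
  "carrier (coset_wreath G H) = carrier G \<times> left_invariant_sets G H"
  "(g, A) \<otimes>\<^bsub>coset_wreath G H\<^esub> (h, B) =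
    (g \<otimes>\<^bsub>G\<^esub> h, sym_diff {x \<in> carrier G. x \<otimes>\<^bsub>G\<^esub> inv\<^bsub>G\<^esub> h \<in> A} B)"
  "\<one>\<^bsub>coset_wreath G H\<^esub> = (\<one>\<^bsub>G\<^esub>, {})"
  by (simp_all add: coset_wreath_def)

context group
begin

text \<open>Invariance under \<open>inv h\<close> gives the converse implication; the equivalence is
  what makes invariance pass to symmetric differences.\<close>

lemma left_invariant_sets_mem_iff:
  assumes "subgroup H G" "B \<in> left_invariant_sets G H" "h \<in> H" "x \<in> carrier G"
  shows "h \<otimes> x \<in> B \<longleftrightarrow> x \<in> B"
proof
  have h: "h \<in> carrier G" "inv h \<in> H"
    using assms(1,3) by (auto simp: subgroup.mem_carrier subgroup.m_inv_closed)
  assume "h \<otimes> x \<in> B"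
  then have "inv h \<otimes> (h \<otimes> x) \<in> B"
    using assms(2) h by (auto simp: left_invariant_sets_def)
  then show "x \<in> B" using h assms(4) by (simp flip: m_assoc)
qed (use assms in \<open>auto simp: left_invariant_sets_def\<close>)

text \<open>Left multiplication by \<open>H\<close> commutes with right translation.\<close>

lemma left_invariant_sets_translate:
  assumes "subgroup H G" "A \<in> left_invariant_sets G H" "g \<in> carrier G"
  shows "{x \<in> carrier G. x \<otimes> g \<in> A} \<in> left_invariant_sets G H"
  using assms by (auto simp: left_invariant_sets_def m_assoc subgroup.mem_carrier)

lemma left_invariant_sets_sym_diff:
  assumes "subgroup H G" "A \<in> left_invariant_sets G H" "B \<in> left_invariant_sets G H"
  shows "sym_diff A B \<in> left_invariant_sets G H"
proof -
  have "h \<otimes> x \<in> sym_diff A B" if "h \<in> H" "x \<in> sym_diff A B" for h x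
  proof -
    have "x \<in> carrier G" using that assms by (auto simp: left_invariant_sets_def)
    then show ?thesis
      using that left_invariant_sets_mem_iff[OF assms(1)] assms(2,3) by blast
  qed
  then show ?thesis using assms(2,3) by (auto simp: left_invariant_sets_def)
qed

text \<open>An invariant set is the union of the cosets of its elements, so it is determined by a
  subset of the finite coset space.\<close>

lemma finite_left_invariant_sets:
  assumes "finite_index H G"
  shows "finite (left_invariant_sets G H)"
proof (rule finite_subset)
  have H: "subgroup H G" using assms by (simp add: finite_index_def)
  show "left_invariant_sets G H \<subseteq> Union ` Pow (rcosets H)"
  proof
    fix B assume B: "B \<in> left_invariant_sets G H"
    then have sub: "B \<subseteq> carrier G" by (simp add: left_invariant_sets_def)
    have "B = (\<Union>x\<in>B. H #> x)"
      using B H sub subgroup.one_closed[OF H]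
      by (fastforce simp: left_invariant_sets_def r_coset_def intro: bexI[of _ "\<one>"])
    moreover have "(\<lambda>x. H #> x) ` B \<in> Pow (rcosets H)"
      using sub by (auto simp: RCOSETS_def)
    ultimately show "B \<in> Union ` Pow (rcosets H)" by blast
  qed
qed (use assms in \<open>simp add: finite_index_def\<close>)

lemma group_coset_wreath:
  assumes H: "subgroup H G"
  shows "group (coset_wreath G H)"
proof (rule groupI)
  fix p q assume "p \<in> carrier (coset_wreath G H)" "q \<in> carrier (coset_wreath G H)"
  then show "p \<otimes>\<^bsub>coset_wreath G H\<^esub> q \<in> carrier (coset_wreath G H)"
    by (auto intro!: left_invariant_sets_sym_diff[OF H] left_invariant_sets_translate[OF H])
next
  show "\<one>\<^bsub>coset_wreath G H\<^esub> \<in> carrier (coset_wreath G H)"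
    by (simp add: left_invariant_sets_def)
next
  fix p q r
  assume "p \<in> carrier (coset_wreath G H)" "q \<in> carrier (coset_wreath G H)"
    "r \<in> carrier (coset_wreath G H)"
  then show "p \<otimes>\<^bsub>coset_wreath G H\<^esub> q \<otimes>\<^bsub>coset_wreath G H\<^esub> r =
      p \<otimes>\<^bsub>coset_wreath G H\<^esub> (q \<otimes>\<^bsub>coset_wreath G H\<^esub> r)"
    by (auto simp: m_assoc inv_mult_group)
next
  fix p assume "p \<in> carrier (coset_wreath G H)"
  then obtain g A where p: "p = (g, A)" "g \<in> carrier G" "A \<in> left_invariant_sets G H" by auto
  then have "A \<subseteq> carrier G" by (simp add: left_invariant_sets_def)
  then show "\<one>\<^bsub>coset_wreath G H\<^esub> \<otimes>\<^bsub>coset_wreath G H\<^esub> p = p"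
    using p by auto
  \<comment> \<open>Multiplying by \<open>p\<close> translates the second component back to
    \<open>A\<close>, and its symmetric difference with \<open>A\<close> is empty.\<close>
  have "(inv g, {x \<in> carrier G. x \<otimes> g \<in> A}) \<otimes>\<^bsub>coset_wreath G H\<^esub> p = \<one>\<^bsub>coset_wreath G H\<^esub>"
    using p \<open>A \<subseteq> carrier G\<close> by (auto simp: m_assoc)
  then show "\<exists>q\<in>carrier (coset_wreath G H). q \<otimes>\<^bsub>coset_wreath G H\<^esub> p = \<one>\<^bsub>coset_wreath G H\<^esub>"
    using p by (intro bexI[of _ "(inv g, {x \<in> carrier G. x \<otimes> g \<in> A})"])
      (auto intro: left_invariant_sets_translate[OF H])
qed

text \<open>The pair \<open>(x, H)\<close> is the product of \<open>(x, {})\<close> with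
  \<open>(\<one>, H)\<close>, the latter being the base element supported at the coset
  \<open>H\<close>.\<close>

lemma coset_wreath_conjugate_iff:
  assumes H: "subgroup H G" and x: "x \<in> H" and y: "y \<in> H"
  shows "conjugate_in (coset_wreath G H) (x, H) (y, H) \<longleftrightarrow> conjugate_in (G\<lparr>carrier := H\<rparr>) x y"
proof -
  interpret K: group "coset_wreath G H" by (rule group_coset_wreath[OF H])
  interpret H: group "G\<lparr>carrier := H\<rparr>" by (rule subgroup.subgroup_is_group[OF H is_group])
  have sub: "H \<subseteq> carrier G" by (rule subgroup.subset[OF H])
  have HH: "H \<in> left_invariant_sets G H"
    using sub H by (auto simp: left_invariant_sets_def subgroup.m_closed)
  have shift: "a \<otimes> inv h \<in> H \<longleftrightarrow> a \<in> H" if "h \<in> H" "a \<in> carrier G" for a h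
  proof
    assume "a \<otimes> inv h \<in> H"
    then have "a \<otimes> inv h \<otimes> h \<in> H" using that(1) H by (blast intro: subgroup.m_closed)
    then show "a \<in> H" using that sub by (simp add: m_assoc subsetD)
  qed (use that H in \<open>auto intro: subgroup.m_closed subgroup.m_inv_closed\<close>)
  have "(\<exists>p\<in>carrier (coset_wreath G H). (y, H) \<otimes>\<^bsub>coset_wreath G H\<^esub> p = p \<otimes>\<^bsub>coset_wreath G H\<^esub> (x, H))
      \<longleftrightarrow> (\<exists>g\<in>H. y \<otimes> g = g \<otimes> x)"
  proof
    assume "\<exists>p\<in>carrier (coset_wreath G H). (y, H) \<otimes>\<^bsub>coset_wreath G H\<^esub> p = p \<otimes>\<^bsub>coset_wreath G H\<^esub> (x, H)"
    then obtain g B where g: "g \<in> carrier G" and B: "B \<in> left_invariant_sets G H"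
      and eq: "y \<otimes> g = g \<otimes> x"
      and sets: "sym_diff {a \<in> carrier G. a \<otimes> inv g \<in> H} B = sym_diff {a \<in> carrier G. a \<otimes> inv x \<in> B} H"
      by auto
    \<comment> \<open>The two sides of \<open>sets\<close> are compared at \<open>\<one>\<close>,
      which represents the coset \<open>H\<close>.\<close>
    have "inv x \<in> H" "x \<in> carrier G" using x sub H by (auto intro: subgroup.m_inv_closed)
    then have "inv x \<in> B \<longleftrightarrow> \<one> \<in> B"
      using left_invariant_sets_mem_iff[OF H B, of "inv x" \<one>] by simp
    moreover have "\<one> \<in> sym_diff {a \<in> carrier G. a \<otimes> inv g \<in> H} B \<longleftrightarrow> (inv g \<in> H) \<noteq> (\<one> \<in> B)"
      using g by auto
    moreover have "\<one> \<in> sym_diff {a \<in> carrier G. a \<otimes> inv x \<in> B} H \<longleftrightarrow> inv x \<notin> B"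
      using \<open>x \<in> carrier G\<close> subgroup.one_closed[OF H] by auto
    \<comment> \<open>Whether or not \<open>\<one>\<close> lies in \<open>B\<close>, the two
      memberships agree only if \<open>inv g\<close> lies in \<open>H\<close>.\<close>
    ultimately have "inv g \<in> H" using sets by auto
    then have "g \<in> H" using g subgroup.m_inv_closed[OF H] by fastforce
    with eq show "\<exists>g\<in>H. y \<otimes> g = g \<otimes> x" by blast
  next
    assume "\<exists>g\<in>H. y \<otimes> g = g \<otimes> x"
    then obtain g where g: "g \<in> H" "y \<otimes> g = g \<otimes> x" by blast
    \<comment> \<open>Translation by an element of \<open>H\<close> fixes the base element
      \<open>H\<close>, so \<open>g\<close> with trivial base component conjugates.\<close>
    have "{a \<in> carrier G. a \<otimes> inv g \<in> H} = H" using shift[OF g(1)] sub by auto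
    then have "(y, H) \<otimes>\<^bsub>coset_wreath G H\<^esub> (g, {}) = (g, {}) \<otimes>\<^bsub>coset_wreath G H\<^esub> (x, H)"
      using g by simp
    then show "\<exists>p\<in>carrier (coset_wreath G H). (y, H) \<otimes>\<^bsub>coset_wreath G H\<^esub> p = p \<otimes>\<^bsub>coset_wreath G H\<^esub> (x, H)"
      using g sub by (intro bexI[of _ "(g, {})"]) (auto simp: left_invariant_sets_def)
  qed
  then show ?thesis
    using K.conjugate_in_iff[of "(x, H)" "(y, H)"] H.conjugate_in_iff[of x y] x y sub HH by auto
qed

end

section \<open>Overgroups with finitely many coset representatives\<close>

lemma (in group) finite_rcosets_if_factorization:
  assumes "P \<subseteq> carrier G" "finite T" "T \<subseteq> carrier G"
    and "subgroup P G" and "\<And>k. k \<in> carrier G \<Longrightarrow> \<exists>p\<in>P. \<exists>t\<in>T. k = p \<otimes> t"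
  shows "finite (rcosets P)"
proof (rule finite_subset)
  show "rcosets P \<subseteq> (\<lambda>t. P #> t) ` T"
  proof
    fix C assume "C \<in> rcosets P"
    then obtain k where k: "k \<in> carrier G" "C = P #> k" by (auto simp: RCOSETS_def)
    then obtain p t where "p \<in> P" "t \<in> T" "k = p \<otimes> t" using assms(5) by blast
    \<comment> \<open>The factor \<open>p\<close> is absorbed by \<open>P\<close>, so every coset is
      represented in \<open>T\<close>.\<close>
    moreover from this have "P #> (p \<otimes> t) = P #> p #> t"
      using assms(1,3) by (intro coset_mult_assoc[symmetric]) auto
    moreover have "P #> p = P"
      using \<open>p \<in> P\<close> assms(1,4) by (intro coset_join2) auto
    ultimately show "C \<in> (\<lambda>t. P #> t) ` T" using k by simp
  qed
qed (use assms in simp)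

lemma conjugate_in_iso_iff:
  assumes "group A" "group B" "f \<in> iso A B" "x \<in> carrier A" "y \<in> carrier A"
  shows "conjugate_in B (f x) (f y) \<longleftrightarrow> conjugate_in A x y"
proof -
  interpret A: group A by fact
  interpret B: group B by fact
  interpret f: group_hom A B f
    using assms(3) by unfold_locales (simp add: iso_def)
  have inj: "inj_on f (carrier A)" and img: "f ` carrier A = carrier B"
    using assms(3) by (auto simp: iso_def bij_betw_def)
  have "f y \<otimes>\<^bsub>B\<^esub> f g = f g \<otimes>\<^bsub>B\<^esub> f x \<longleftrightarrow> y \<otimes>\<^bsub>A\<^esub> g = g \<otimes>\<^bsub>A\<^esub> x" if "g \<in> carrier A" for g
    using inj_onD[OF inj, of "y \<otimes>\<^bsub>A\<^esub> g" "g \<otimes>\<^bsub>A\<^esub> x"] that assms(4,5)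
    by (auto simp flip: f.hom_mult)
  then show ?thesis
    using assms(4,5) by (auto simp: A.conjugate_in_iff B.conjugate_in_iff simp flip: img)
qed

text \<open>The same finite \<open>T\<close> serves twice: it represents all cosets of the image of
  \<open>G\<close>, and it completes the image of \<open>S\<close> to a generating set.\<close>

lemma (in group) finite_index_overgroup_generated:
  assumes "finite_generating_set G S" "group K" "\<phi> \<in> mon G K"
    and "finite T" "T \<subseteq> carrier K"
    and "\<And>k. k \<in> carrier K \<Longrightarrow> \<exists>g\<in>carrier G. \<exists>t\<in>T. k = \<phi> g \<otimes>\<^bsub>K\<^esub> t"
  shows "finite_index_overgroup G \<phi> K" and "finite_generating_set K (\<phi> ` S \<union> T)"
proof -
  interpret K: group K by fact
  interpret \<phi>: group_hom G K \<phi>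
    using assms(3) by unfold_locales (simp add: mon_def)
  have S: "finite S" "S \<subseteq> carrier G" "generate G S = carrier G"
    using assms(1) by (auto simp: finite_generating_set_def)
  have sub: "subgroup (\<phi> ` carrier G) K" by (rule \<phi>.img_is_subgroup)
  have "finite (rcosets\<^bsub>K\<^esub> (\<phi> ` carrier G))"
    by (rule K.finite_rcosets_if_factorization[of _ T]) (use assms sub in auto)
  with sub show "finite_index_overgroup G \<phi> K"
    using assms by (simp add: finite_index_overgroup_def finite_index_def)
  have gens: "\<phi> ` S \<union> T \<subseteq> carrier K" using S assms(5) by auto
  have "k \<in> generate K (\<phi> ` S \<union> T)" if "k \<in> carrier K" for k
  proof -
    obtain g t where g: "g \<in> carrier G" "t \<in> T" "k = \<phi> g \<otimes>\<^bsub>K\<^esub> t" using assms(6)[OF \<open>k \<in> carrier K\<close>] by blast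
    have "\<phi> g \<in> generate K (\<phi> ` S)"
      using \<phi>.generate_img[OF S(2)] g(1) unfolding S(3) by blast
    then have "\<phi> g \<in> generate K (\<phi> ` S \<union> T)"
      using K.mono_generate[of "\<phi> ` S" "\<phi> ` S \<union> T"] by blast
    then show ?thesis using g(2) unfolding g(3) by (intro generate.eng) (auto intro: generate.incl)
  qed
  then show "finite_generating_set K (\<phi> ` S \<union> T)"
    using gens S(1) assms(4) K.generate_incl[OF gens] by (auto simp: finite_generating_set_def)
qed

section \<open>The overgroup and its conjugacy problem\<close>

theorem corollary6p5:
  fixes G :: "('a, 'b) monoid_scheme" and H Y :: "'a set"
  assumes "group G"
    and "\<exists>S. finite_generating_set G S"
    and "finite_index H G"
    and "finite_generating_set (G\<lparr>carrier := H\<rparr>) Y"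
    and "\<not> conjugacy_problem_solvable (G\<lparr>carrier := H\<rparr>) Y"
  shows "\<exists>(K :: ('a \<times> nat) monoid) \<phi>.
    finite_index_overgroup G \<phi> K \<and>
    (\<exists>Z. finite_generating_set K Z) \<and>
    (\<forall>Z. finite_generating_set K Z \<longrightarrow> \<not> conjugacy_problem_solvable K Z)"
proof -
  interpret group G by fact
  have H: "subgroup H G" using assms(3) by (simp add: finite_index_def)
  interpret L: group "G\<lparr>carrier := H\<rparr>" by (rule subgroup.subgroup_is_group[OF H is_group])
  let ?I = "left_invariant_sets G H" and ?W = "coset_wreath G H"
  interpret W: group ?W by (rule group_coset_wreath[OF H])
  have sub: "H \<subseteq> carrier G" by (rule subgroup.subset[OF H])
  have inv_H: "H \<in> ?I" and inv_empty: "{} \<in> ?I"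
    using sub H by (auto simp: left_invariant_sets_def subgroup.m_closed)
  have fin: "finite ?I" by (rule finite_left_invariant_sets[OF assms(3)])
  \<comment> \<open>The overgroup has to consist of pairs of a group element and a natural number,
    so the finitely many invariant sets are numbered.\<close>
  obtain enc :: "'a set \<Rightarrow> nat" where enc: "inj_on enc ?I"
    using finite_imp_inj_to_nat_seg[OF fin] by blast
  define \<iota> where "\<iota> = (\<lambda>p :: 'a \<times> 'a set. (fst p, enc (snd p)))"
  define K where "K = image_group \<iota> ?W"
  define \<phi> where "\<phi> = (\<lambda>g. \<iota> (g, {}))"
  \<comment> \<open>The image of the finite base group; by \<open>factor\<close> below it represents
    all cosets of the image of \<open>G\<close>.\<close>
  define T where "T = (\<lambda>A. \<iota> (\<one>\<^bsub>G\<^esub>, A)) ` ?I"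
  have "inj_on \<iota> (carrier ?W)"
    using enc by (auto simp: \<iota>_def inj_on_def)
  then have \<iota>: "\<iota> \<in> iso ?W K" and K: "group K"
    unfolding K_def by (rule inj_imp_image_group_iso W.inj_imp_image_group_is_group)+
  interpret K: group K by fact
  interpret \<iota>: group_hom ?W K \<iota>
    using \<iota> by unfold_locales (simp add: iso_def)
  have factor: "\<phi> g \<otimes>\<^bsub>K\<^esub> \<iota> (\<one>\<^bsub>G\<^esub>, A) = \<iota> (g, A)" if "g \<in> carrier G" "A \<in> ?I" for g A
    using that inv_empty unfolding \<phi>_def by (subst \<iota>.hom_mult[symmetric]) auto
  have \<phi>: "\<phi> \<in> mon G K"
  proof -
    have "\<phi> x \<otimes>\<^bsub>K\<^esub> \<phi> y = \<phi> (x \<otimes>\<^bsub>G\<^esub> y)" if "x \<in> carrier G" "y \<in> carrier G" for x y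
      using that inv_empty unfolding \<phi>_def by (subst \<iota>.hom_mult[symmetric]) auto
    moreover have "\<phi> x \<in> carrier K" if "x \<in> carrier G" for x
      using that inv_empty unfolding \<phi>_def by (intro \<iota>.hom_closed) simp
    moreover have "inj_on \<phi> (carrier G)"
      by (auto simp: inj_on_def \<phi>_def \<iota>_def)
    ultimately show ?thesis by (auto simp: mon_def hom_def)
  qed
  obtain S where S: "finite_generating_set G S" using assms(2) by blast
  have T: "finite T" "T \<subseteq> carrier K"
    using fin by (auto simp: T_def)
  have "\<exists>g\<in>carrier G. \<exists>t\<in>T. k = \<phi> g \<otimes>\<^bsub>K\<^esub> t" if "k \<in> carrier K" for k
  proof -
    have "k \<in> \<iota> ` carrier ?W"
      using that \<iota> by (simp add: iso_def bij_betw_def)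
    then obtain g A where "k = \<iota> (g, A)" "g \<in> carrier G" "A \<in> ?I"
      by auto
    then show ?thesis using factor by (auto simp: T_def)
  qed
  note over = finite_index_overgroup_generated[OF S K \<phi> T this]
  have "\<not> conjugacy_problem_solvable K Z" if Z: "finite_generating_set K Z" for Z
  proof
    assume solvable: "conjugacy_problem_solvable K Z"
    \<comment> \<open>Here \<open>\<iota> (\<one>, H)\<close> takes the role of \<open>t\<close>: by
      \<open>factor\<close> the products are \<open>\<iota> (x, H)\<close> and
      \<open>\<iota> (y, H)\<close>, so the claim is the criterion for the wreath product carried
      over by \<open>\<iota>\<close>.\<close>
    have "conjugate_in K (\<phi> x \<otimes>\<^bsub>K\<^esub> \<iota> (\<one>\<^bsub>G\<^esub>, H)) (\<phi> y \<otimes>\<^bsub>K\<^esub> \<iota> (\<one>\<^bsub>G\<^esub>, H)) \<longleftrightarrow>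
        conjugate_in (G\<lparr>carrier := H\<rparr>) x y" if "x \<in> H" "y \<in> H" for x y
      using that sub inv_H conjugate_in_iso_iff[OF W.is_group K \<iota>]
      by (simp add: factor subsetD coset_wreath_conjugate_iff[OF H])
    moreover have "\<phi> \<in> hom (G\<lparr>carrier := H\<rparr>) K"
      using \<phi> sub by (auto simp: mon_def hom_def)
    moreover have "\<iota> (\<one>\<^bsub>G\<^esub>, H) \<in> carrier K" using inv_H by simp
    moreover have "finite Y" "Y \<subseteq> carrier (G\<lparr>carrier := H\<rparr>)"
      using assms(4) by (auto simp: finite_generating_set_def)
    ultimately have "conjugacy_problem_solvable (G\<lparr>carrier := H\<rparr>) Y"
      by (intro conjugacy_problem_solvable_reduction[OF L.is_group _ _ K Z solvable]) auto
    then show False using assms(5) by blast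
  qed
  with over show ?thesis by blast
qed

end
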